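(* Let $m > 2$ be an integer and let $D_{2m} = \langle a, b : a^m = b^2 = 1, bab^{-1} = a^{-1} \rangle$ be the dihedral group of order $2m$. Then the Laplacian spectrum of the non-commuting graph $\mathcal{A}_{D_{2m}}$ of $D_{2m}$ is $$\{0, m^{m-2}, (2m-1)^m\}$$ if $m$ is odd, and $$\{0, m^{m-3}, (2m-4)^{\frac{m}{2}}, (2m-2)^{\frac{m}{2}}\}$$ if $m$ is even.
   Context: For a finite non-abelian group $G$ with centre $Z(G)$, the non-commuting graph $\mathcal{A}_G$ is the simple undirected graph with vertex set $G \setminus Z(G)$ in which two vertices $x,y$ are adjacent if and only if $xy \neq yx$. The Laplacian matrix of a finite graph is $D - A$, with $D$ the degree matrix and $A$ the adjacency matrix. The Laplacian spectrum is the multiset of eigenvalues of the Laplacian matrix; $\{\dots,\alpha^{a},\dots\}$ means the eigenvalue $\alpha$ is listed with multiplicity $a$ (not a power; no exponent means once, exponent $0$ means the entry is absent, and if listed values coincide their multiplicities add). *)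

theory Defs
  imports
    "HOL-Algebra.Group"
    "Graph_Theory.Pair_Digraph"
    "Jordan_Normal_Form.Char_Poly"
begin

section \<open>Groups given by generators and relations\<close>

text \<open>
  The letter \<open>(g, True)\<close> stands for the generator \<open>g\<close>, and \<open>(g, False)\<close> for its formal inverse.
  The generators are all elements of the type \<open>'g\<close>; a relation is a pair of words.
\<close>

type_synonym 'g word = "('g \<times> bool) list"

inductive word_eq :: "('g word \<times> 'g word) set \<Rightarrow> 'g word \<Rightarrow> 'g word \<Rightarrow> bool"
  for R :: "('g word \<times> 'g word) set" where
  word_eq_refl: "word_eq R u u"
| word_eq_sym: "word_eq R u v \<Longrightarrow> word_eq R v u"
| word_eq_trans: "word_eq R u v \<Longrightarrow> word_eq R v w \<Longrightarrow> word_eq R u w"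
| word_eq_cancel: "word_eq R (u @ [(g, s), (g, \<not> s)] @ v) (u @ v)"
| word_eq_rel: "(l, r) \<in> R \<Longrightarrow> word_eq R (u @ l @ v) (u @ r @ v)"

definition word_rel :: "('g word \<times> 'g word) set \<Rightarrow> ('g word \<times> 'g word) set" where
  "word_rel R = {(u, v). word_eq R u v}"

definition presented_group :: "('g word \<times> 'g word) set \<Rightarrow> 'g word set monoid" where
  "presented_group R =
     \<lparr> carrier = UNIV // word_rel R,
       monoid.mult = (\<lambda>X Y. \<Union>u\<in>X. \<Union>v\<in>Y. word_rel R `` {u @ v}),
       one = word_rel R `` {[]} \<rparr>"

datatype dihedral_gen = Gen_a | Gen_b

definition dihedral_relations :: "nat \<Rightarrow> (dihedral_gen word \<times> dihedral_gen word) set" where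
  "dihedral_relations m =
     {(replicate m (Gen_a, True), []),
      (replicate 2 (Gen_b, True), []),
      ([(Gen_b, True), (Gen_a, True), (Gen_b, False)], [(Gen_a, False)])}"

definition dihedral_group :: "nat \<Rightarrow> dihedral_gen word set monoid" where
  "dihedral_group m = presented_group (dihedral_relations m)"

lemma equiv_word_rel: "equiv UNIV (word_rel R)"
  unfolding word_rel_def
  by (intro equivI refl_onI symI transI) (auto intro: word_eq.intros)

lemma word_eq_context: "word_eq R u v \<Longrightarrow> word_eq R (p @ u @ q) (p @ v @ q)"
proof (induction rule: word_eq.induct)
  case (word_eq_cancel u g s v)
  show ?case using word_eq.word_eq_cancel[of R "p @ u" g s "v @ q"] by simp
next
  case (word_eq_rel l r u v)
  then show ?case using word_eq.word_eq_rel[of l r R "p @ u" "v @ q"] by simp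
next
  case (word_eq_sym u v)
  show ?case by (rule word_eq.word_eq_sym) fact
next
  case (word_eq_trans u v w)
  show ?case by (rule word_eq.word_eq_trans) fact+
qed (rule word_eq.word_eq_refl)

lemma word_eq_append: "word_eq R u u' \<Longrightarrow> word_eq R v v' \<Longrightarrow> word_eq R (u @ v) (u' @ v')"
  using word_eq_context[of R u u' "[]" v] word_eq_context[of R v v' u' "[]"]
  by (auto intro: word_eq_trans)

lemma word_class_eq_iff: "word_rel R `` {u} = word_rel R `` {v} \<longleftrightarrow> word_eq R u v"
  using eq_equiv_class_iff[OF equiv_word_rel, of u v R] by (auto simp: word_rel_def)

lemma carrier_presented_group:
  "X \<in> carrier (presented_group R) \<longleftrightarrow> (\<exists>u. X = word_rel R `` {u})"
  by (auto simp: presented_group_def quotient_def)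

lemma one_presented_group: "\<one>\<^bsub>presented_group R\<^esub> = word_rel R `` {[]}"
  by (simp add: presented_group_def)

lemma mult_presented_group:
  "word_rel R `` {u} \<otimes>\<^bsub>presented_group R\<^esub> word_rel R `` {v} = word_rel R `` {u @ v}"
proof -
  have "word_rel R `` {x @ y} = word_rel R `` {u @ v}"
    if "x \<in> word_rel R `` {u}" "y \<in> word_rel R `` {v}" for x y
    using that unfolding word_class_eq_iff
    by (auto simp: word_rel_def intro: word_eq_sym word_eq_append)
  moreover have "u \<in> word_rel R `` {u}" "v \<in> word_rel R `` {v}"
    by (auto simp: word_rel_def word_eq_refl)
  ultimately have "(\<Union>x\<in>word_rel R `` {u}. \<Union>y\<in>word_rel R `` {v}. word_rel R `` {x @ y}) =
      word_rel R `` {u @ v}"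
    by blast
  then show ?thesis
    by (simp only: presented_group_def monoid.simps)
qed

lemma word_eq_inverse:
  "word_eq R (rev (map (\<lambda>(g, s). (g, \<not> s)) u) @ u) []"
proof (induction u)
  case (Cons x u)
  obtain g s where x: "x = (g, s)" by (cases x)
  let ?i = "rev (map (\<lambda>(g, s). (g, \<not> s)) u)"
  have "word_eq R (?i @ [(g, \<not> s), (g, \<not> \<not> s)] @ u) (?i @ u)"
    by (rule word_eq_cancel)
  with Cons show ?case by (auto simp: x intro: word_eq_trans)
qed (simp add: word_eq_refl)

lemma group_presented_group: "group (presented_group R)"
proof (rule groupI)
  fix X assume "X \<in> carrier (presented_group R)"
  then obtain u where X: "X = word_rel R `` {u}" by (auto simp: carrier_presented_group)
  let ?Y = "word_rel R `` {rev (map (\<lambda>(g, s). (g, \<not> s)) u)}"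
  have "?Y \<otimes>\<^bsub>presented_group R\<^esub> X = \<one>\<^bsub>presented_group R\<^esub>"
    unfolding X mult_presented_group one_presented_group word_class_eq_iff
    by (rule word_eq_inverse)
  moreover have "?Y \<in> carrier (presented_group R)"
    unfolding carrier_presented_group by blast
  ultimately show "\<exists>Y\<in>carrier (presented_group R). Y \<otimes>\<^bsub>presented_group R\<^esub> X = \<one>\<^bsub>presented_group R\<^esub>"
    by blast
next
  fix X Y Z
  assume "X \<in> carrier (presented_group R)" "Y \<in> carrier (presented_group R)"
    "Z \<in> carrier (presented_group R)"
  then obtain u v w where "X = word_rel R `` {u}" "Y = word_rel R `` {v}" "Z = word_rel R `` {w}"
    unfolding carrier_presented_group by blast
  then show "X \<otimes>\<^bsub>presented_group R\<^esub> Y \<otimes>\<^bsub>presented_group R\<^esub> Z =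
             X \<otimes>\<^bsub>presented_group R\<^esub> (Y \<otimes>\<^bsub>presented_group R\<^esub> Z)"
    by (simp only: mult_presented_group append_assoc)
next
  fix X Y assume "X \<in> carrier (presented_group R)" "Y \<in> carrier (presented_group R)"
  then show "X \<otimes>\<^bsub>presented_group R\<^esub> Y \<in> carrier (presented_group R)"
    unfolding carrier_presented_group using mult_presented_group by metis
next
  fix X assume "X \<in> carrier (presented_group R)"
  then show "\<one>\<^bsub>presented_group R\<^esub> \<otimes>\<^bsub>presented_group R\<^esub> X = X"
    unfolding carrier_presented_group one_presented_group
    using mult_presented_group append_Nil by metis
next
  show "\<one>\<^bsub>presented_group R\<^esub> \<in> carrier (presented_group R)"
    unfolding carrier_presented_group one_presented_group by blast
qed

section \<open>The non-commuting graph\<close>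

definition group_center :: "('a, 'b) monoid_scheme \<Rightarrow> 'a set" where
  "group_center G = {z \<in> carrier G. \<forall>g\<in>carrier G. z \<otimes>\<^bsub>G\<^esub> g = g \<otimes>\<^bsub>G\<^esub> z}"

definition non_commuting_graph :: "('a, 'b) monoid_scheme \<Rightarrow> 'a pair_pre_digraph" where
  "non_commuting_graph G =
     \<lparr> pverts = carrier G - group_center G,
       parcs = {(x, y). x \<in> carrier G - group_center G \<and> y \<in> carrier G - group_center G \<and>
                        x \<otimes>\<^bsub>G\<^esub> y \<noteq> y \<otimes>\<^bsub>G\<^esub> x} \<rparr>"

text \<open>\<open>pair_graph\<close> is the locale of finite symmetric loop-free digraphs, that is, of finite simple
  undirected graphs; an edge is represented by its two orientations.\<close>

lemma pair_graph_non_commuting_graph: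
  assumes "finite (carrier G)"
  shows "pair_graph (non_commuting_graph G)"
proof -
  have "parcs (non_commuting_graph G) \<subseteq> carrier G \<times> carrier G"
    by (auto simp: non_commuting_graph_def)
  then have "finite (parcs (non_commuting_graph G))"
    using assms finite_subset by blast
  then show ?thesis
    using assms
    by unfold_locales (auto simp: non_commuting_graph_def symmetric_def intro!: symI)
qed

section \<open>The Laplacian spectrum\<close>

text \<open>Rows and columns are indexed by the positions of a list \<open>vs\<close> that enumerates the vertices.
  In a symmetric digraph, \<open>out_degree\<close> is the degree of the underlying undirected graph.\<close>

definition adjacency_matrix :: "'a pair_pre_digraph \<Rightarrow> 'a list \<Rightarrow> real mat" where
  "adjacency_matrix G vs =
     mat (length vs) (length vs) (\<lambda>(i, j). if (vs ! i, vs ! j) \<in> parcs G then 1 else 0)"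

definition degree_matrix :: "'a pair_pre_digraph \<Rightarrow> 'a list \<Rightarrow> real mat" where
  "degree_matrix G vs =
     mat (length vs) (length vs)
       (\<lambda>(i, j). if i = j then real (out_degree (with_proj G) (vs ! i)) else 0)"

definition laplacian_matrix :: "'a pair_pre_digraph \<Rightarrow> 'a list \<Rightarrow> real mat" where
  "laplacian_matrix G vs = degree_matrix G vs - adjacency_matrix G vs"

definition eigenvalue_mset :: "'a :: field mat \<Rightarrow> 'a multiset" where
  "eigenvalue_mset A = proots (char_poly A)"

text \<open>The Laplacian matrix of an undirected graph is real symmetric, so no eigenvalue is lost by
  working over the reals. The chosen enumeration is immaterial; see \<open>laplacian_spectrum_eq\<close>.\<close>

definition laplacian_spectrum :: "'a pair_pre_digraph \<Rightarrow> real multiset" where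
  "laplacian_spectrum G =
     eigenvalue_mset (laplacian_matrix G (SOME vs. distinct vs \<and> set vs = pverts G))"

lemma laplacian_matrix_similar:
  fixes vs ws :: "'a list"
  assumes "distinct vs" "distinct ws" "set vs = set ws"
  shows "similar_mat (laplacian_matrix G vs) (laplacian_matrix G ws)"
proof -
  define n where "n = length vs"
  have lw: "length ws = n"
    using assms distinct_card[of vs] distinct_card[of ws] by (simp add: n_def)
  define f where "f = (\<lambda>v w :: 'a. if v = w then 1 else (0 :: real))"
  define P where "P = mat n n (\<lambda>(i, j). f (vs ! i) (ws ! j))"
  define Q where "Q = mat n n (\<lambda>(i, j). f (ws ! i) (vs ! j))"
  define h where "h = (\<lambda>v w. (if v = w then real (out_degree (with_proj G) v) else 0) -
                              (if (v, w) \<in> parcs G then 1 else 0))"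
  have L: "laplacian_matrix G us = mat n n (\<lambda>(i, j). h (us ! i) (us ! j))"
    if "distinct us" "length us = n" for us
    using that by (intro eq_matI)
      (auto simp: laplacian_matrix_def degree_matrix_def adjacency_matrix_def h_def
                  nth_eq_iff_index_eq)
  have sum_us: "(\<Sum>k = 0..<n. g (us ! k)) = (\<Sum>v\<in>set us. g v)"
    if "distinct us" "length us = n" for us and g :: "_ \<Rightarrow> real"
  proof -
    have "bij_betw ((!) us) {0..<n} (set us)"
      using bij_betw_nth[OF that(1), of "{0..<n}" "set us"] that(2) by (simp add: atLeast0LessThan)
    then show ?thesis by (rule sum.reindex_bij_betw)
  qed
  have mem: "vs ! i \<in> set ws" "ws ! i \<in> set ws" "vs ! i \<in> set vs" "ws ! i \<in> set vs" if "i < n" for i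
    using that lw assms(3) by (metis n_def nth_mem)+
  have PQ: "P * Q = 1\<^sub>m n"
  proof (rule eq_matI)
    fix i j assume "i < dim_row (1\<^sub>m n :: real mat)" "j < dim_col (1\<^sub>m n :: real mat)"
    then have ij: "i < n" "j < n" by auto
    have "(P * Q) $$ (i, j) = (\<Sum>k = 0..<n. f (vs ! i) (ws ! k) * f (ws ! k) (vs ! j))"
      using ij by (simp add: P_def Q_def scalar_prod_def)
    also have "\<dots> = (\<Sum>v\<in>set ws. f (vs ! i) v * f v (vs ! j))"
      using sum_us[OF assms(2) lw, of "\<lambda>v. f (vs ! i) v * f v (vs ! j)"] .
    also have "\<dots> = (\<Sum>v\<in>set ws. if v = vs ! i then f v (vs ! j) else 0)"
      by (rule sum.cong) (auto simp: f_def)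
    also have "\<dots> = f (vs ! i) (vs ! j)" using mem ij by simp
    also have "\<dots> = 1\<^sub>m n $$ (i, j)"
      using ij assms(1) by (simp add: f_def nth_eq_iff_index_eq n_def)
    finally show "(P * Q) $$ (i, j) = 1\<^sub>m n $$ (i, j)" .
  qed (auto simp: P_def Q_def)
  have QP: "Q * P = 1\<^sub>m n"
    using mat_mult_left_right_inverse[of P n Q] PQ by (auto simp: P_def Q_def)
  have "laplacian_matrix G vs * P = P * laplacian_matrix G ws"
  proof (rule eq_matI)
    fix i j assume "i < dim_row (P * laplacian_matrix G ws)" "j < dim_col (P * laplacian_matrix G ws)"
    then have ij: "i < n" "j < n" using lw by (auto simp: P_def L[OF assms(2)])
    have "(laplacian_matrix G vs * P) $$ (i, j) = (\<Sum>k = 0..<n. h (vs ! i) (vs ! k) * f (vs ! k) (ws ! j))"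
      using ij by (simp add: P_def L[OF assms(1) n_def[symmetric]] scalar_prod_def)
    also have "\<dots> = (\<Sum>v\<in>set vs. h (vs ! i) v * f v (ws ! j))"
      using sum_us[OF assms(1) n_def[symmetric], of "\<lambda>v. h (vs ! i) v * f v (ws ! j)"] .
    also have "\<dots> = (\<Sum>v\<in>set vs. if v = ws ! j then h (vs ! i) v else 0)"
      by (rule sum.cong) (auto simp: f_def)
    also have "\<dots> = h (vs ! i) (ws ! j)" using mem ij by simp
    also have "\<dots> = (\<Sum>v\<in>set ws. if v = vs ! i then h v (ws ! j) else 0)"
      using mem ij by simp
    also have "\<dots> = (\<Sum>v\<in>set ws. f (vs ! i) v * h v (ws ! j))"
      by (rule sum.cong) (auto simp: f_def)
    also have "\<dots> = (\<Sum>k = 0..<n. f (vs ! i) (ws ! k) * h (ws ! k) (ws ! j))"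
      using sum_us[OF assms(2) lw, of "\<lambda>v. f (vs ! i) v * h v (ws ! j)"] by simp
    also have "\<dots> = (P * laplacian_matrix G ws) $$ (i, j)"
      using ij by (simp add: P_def L[OF assms(2) lw] scalar_prod_def)
    finally show "(laplacian_matrix G vs * P) $$ (i, j) = (P * laplacian_matrix G ws) $$ (i, j)" .
  qed (auto simp: P_def L[OF assms(1) n_def[symmetric]] L[OF assms(2) lw])
  moreover have carr: "laplacian_matrix G vs \<in> carrier_mat n n" "laplacian_matrix G ws \<in> carrier_mat n n"
    "P \<in> carrier_mat n n" "Q \<in> carrier_mat n n"
    by (auto simp: P_def Q_def L[OF assms(1) n_def[symmetric]] L[OF assms(2) lw])
  ultimately have "laplacian_matrix G vs * (P * Q) = P * laplacian_matrix G ws * Q"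
    using assoc_mult_mat[OF carr(1,3,4)] by simp
  then have "laplacian_matrix G vs = P * laplacian_matrix G ws * Q"
    using right_mult_one_mat[OF carr(1)] by (simp only: PQ)
  with carr PQ QP show ?thesis
    by (intro similar_matI[of _ _ P Q n]) auto
qed

lemma laplacian_spectrum_eq:
  assumes "distinct vs" "set vs = pverts G"
  shows "laplacian_spectrum G = eigenvalue_mset (laplacian_matrix G vs)"
proof -
  define ws where "ws = (SOME vs. distinct vs \<and> set vs = pverts G)"
  have "distinct ws \<and> set ws = pverts G"
    unfolding ws_def by (rule someI[of _ vs]) (use assms in simp)
  then have "similar_mat (laplacian_matrix G ws) (laplacian_matrix G vs)"
    using assms by (intro laplacian_matrix_similar) auto
  then show ?thesis
    by (simp add: laplacian_spectrum_def eigenvalue_mset_def char_poly_similar flip: ws_def)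
qed

end

theory Submission
  imports Defs "HOL-Number_Theory.Cong"
begin

text \<open>Two noncentral elements of a dihedral group commute iff they are both rotations, or are both
  reflections that differ by a central rotation. The non-commuting graph is therefore complete
  multipartite. On \<open>n\<close> vertices its Laplacian sends the indicator of a part of size \<open>p\<close> with vertex \<open>v\<close>
  to \<open>n\<close> times itself minus \<open>p\<close> times the all-ones vector, and \<open>e\<^sub>v\<close> to \<open>(n - p) e\<^sub>v\<close> plus that indicator
  minus the all-ones vector. So it is triangular in the basis formed by the all-ones vector, the
  indicators of all parts but one, and the unit vectors of the vertices outside a transversal.\<close>

section \<open>Spectrum of a complete multipartite graph\<close>

text \<open>The numbers below \<open>r\<close> form a transversal of the parts, which are the fibres of \<open>d\<close>.\<close>

lemma char_poly_complete_multipartite: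
  fixes d :: "nat \<Rightarrow> 'b" and p :: "nat \<Rightarrow> real"
  assumes r: "0 < r" "r \<le> n" "inj_on d {..<r}"
    and d: "\<And>i. i < n \<Longrightarrow> d i \<in> d ` {..<r}"
    and p: "\<And>i. p i = real (card {k. k < n \<and> d k = d i})"
    and L: "L = mat n n (\<lambda>(i, j). (if i = j then real n - p i else 0) - (if d i \<noteq> d j then 1 else 0))"
  shows "char_poly L =
    (\<Prod>i\<leftarrow>[0..<n]. [:- (if i = 0 then 0 else if i < r then real n else real n - p i), 1:])"
proof -
  \<comment> \<open>The columns of \<open>P\<close> are the basis vectors; \<open>T\<close> represents \<open>L\<close> in this basis.\<close>
  define P :: "real mat" where "P = mat n n (\<lambda>(i, j). if j = 0 then 1
    else if j < r then of_bool (d i = d j) else of_bool (i = j))"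
  define T :: "real mat" where "T = mat n n (\<lambda>(i, j). if j = 0 then 0
    else if j < r then if i = 0 then - p j else if i = j then real n else 0
    else if i = 0 then of_bool (d j = d 0) - 1
    else if i < r then of_bool (d i = d j) - of_bool (d j = d 0)
    else if i = j then real n - p j else 0)"
  have carr: "P \<in> carrier_mat n n" "T \<in> carrier_mat n n" "L \<in> carrier_mat n n"
    by (simp_all add: P_def T_def L)
  have "diag_mat P = map (\<lambda>_. 1) [0..<n]"
    by (auto simp: diag_mat_def P_def)
  \<comment> \<open>Above the diagonal the indicator columns vanish because \<open>d\<close>
    separates the indices below \<open>r\<close>, so \<open>P\<close> is lower triangular with unit
    diagonal.\<close>
  moreover have "det P = prod_list (diag_mat P)"
    using r by (intro det_lower_triangular[OF _ carr(1)])
      (auto simp: P_def dest!: inj_onD[OF r(3)])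
  ultimately have "det P \<noteq> 0"
    by (simp add: prod_list_replicate map_replicate_const)
  from det_non_zero_imp_unit[OF carr(1) this, of undefined]
  obtain Q where Q: "Q \<in> carrier_mat n n" "P * Q = 1\<^sub>m n" "Q * P = 1\<^sub>m n"
    by (auto simp: Units_def ring_mat_def)
  have sum_class: "(\<Sum>k = 0..<n. of_bool (d k = d i)) = p i" for i
    by (simp add: p Int_def)
  \<comment> \<open>Only the representative \<open>k'\<close> of the part of \<open>i\<close> can
    contribute. The sum starts at 1 because the part of vertex 0 has no indicator column.\<close>
  have sum_rep: "(\<Sum>k = 1..<r. of_bool (d i = d k) * g k) = (if d i = d 0 then 0 else g k')"
    if i: "i < n" and k': "k' < r" "d i = d k'" for g :: "nat \<Rightarrow> real" and i k'
  proof -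
    have "(\<Sum>k = 1..<r. of_bool (d i = d k) * g k) = (\<Sum>k = 1..<r. if k = k' then g k else 0)"
      using that by (intro sum.cong) (auto dest: inj_onD[OF r(3)])
    also have "\<dots> = (if d i = d 0 then 0 else g k')"
      using that r by (auto simp: Suc_le_eq dest: inj_onD[OF r(3)])
    finally show ?thesis .
  qed
  have LP: "L * P = P * T"
  proof (rule eq_matI)
    fix i j assume "i < dim_row (P * T)" "j < dim_col (P * T)"
    then have ij: "i < n" "j < n" by (auto simp: P_def T_def)
    obtain k' where k': "k' < r" "d i = d k'" using d[OF ij(1)] by auto
    \<comment> \<open>\<open>L\<close> is a diagonal matrix minus the all-ones matrix plus the
      same-part matrix, so each entry of \<open>L * P\<close> splits into three sums.\<close>
    have L': "L $$ (i, k) = of_bool (i = k) * (real n - p i) - 1 + of_bool (d k = d i)"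
      if "k < n" for k
      using that ij by (auto simp: L)
    have "(L * P) $$ (i, j) =
      (\<Sum>k = 0..<n. (of_bool (i = k) * (real n - p i) - 1 + of_bool (d k = d i)) * P $$ (k, j))"
      using ij carr by (simp add: scalar_prod_def L')
    also have "\<dots> = (\<Sum>k = 0..<n. if k = i then (real n - p i) * P $$ (k, j) else 0)
        - (\<Sum>k = 0..<n. P $$ (k, j)) + (\<Sum>k = 0..<n. of_bool (d k = d i) * P $$ (k, j))"
      unfolding sum_subtractf[symmetric] sum.distrib[symmetric]
      by (rule sum.cong) (auto simp: algebra_simps)
    finally have LP: "(L * P) $$ (i, j) = (real n - p i) * P $$ (i, j)
        - (\<Sum>k = 0..<n. P $$ (k, j)) + (\<Sum>k = 0..<n. of_bool (d k = d i) * P $$ (k, j))"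
      using ij by simp
    have PT: "(P * T) $$ (i, j) = (\<Sum>k = 0..<n. P $$ (i, k) * T $$ (k, j))"
      using ij carr by (simp add: scalar_prod_def)
    consider "j = 0" | "0 < j" "j < r" | "r \<le> j" by linarith
    then show "(L * P) $$ (i, j) = (P * T) $$ (i, j)"
    proof cases
      case 1
      then show ?thesis
        unfolding LP PT using ij by (simp add: P_def T_def p Int_def)
    next
      case 2
      have "(\<Sum>k = 0..<n. of_bool (d k = d i) * P $$ (k, j)) =
          (\<Sum>k = 0..<n. of_bool (d i = d j) * of_bool (d k = d i))"
        using ij 2 by (intro sum.cong) (auto simp: P_def)
      also have "\<dots> = of_bool (d i = d j) * p i"
        by (simp only: sum_class flip: sum_distrib_left)
      finally have 3: "(\<Sum>k = 0..<n. of_bool (d k = d i) * P $$ (k, j)) = of_bool (d i = d j) * p i" .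
      have 4: "(\<Sum>k = 0..<n. P $$ (k, j)) = p j"
        unfolding sum_class[symmetric] using ij 2 by (intro sum.cong) (auto simp: P_def)
      have "(\<Sum>k = 0..<n. P $$ (i, k) * T $$ (k, j)) =
          (\<Sum>k = 0..<n. (if k = 0 then - p j else 0) + (if k = j then of_bool (d i = d j) * real n else 0))"
        using ij 2 by (intro sum.cong) (auto simp: P_def T_def)
      also have "\<dots> = of_bool (d i = d j) * real n - p j"
        using ij r by (simp add: sum.distrib)
      finally show ?thesis
        unfolding LP PT 3 4 using ij 2 by (auto simp: P_def p)
    next
      \<comment> \<open>The image of the unit vector at \<open>j\<close> involves the indicator of
        the part of \<open>j\<close>. For the part of vertex 0 this indicator is the all-ones vector
        minus the other indicators, which is where the terms \<open>of_bool (d j = d 0)\<close> in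
        \<open>T\<close> come from.\<close>
      case 3
      then have 4: "P $$ (k, j) = of_bool (k = j)" if "k < n" for k
        using that r ij by (auto simp: P_def)
      have 5: "(\<Sum>k = r..<n. P $$ (i, k) * T $$ (k, j)) = of_bool (i = j) * (real n - p j)"
      proof -
        have "(\<Sum>k = r..<n. P $$ (i, k) * T $$ (k, j)) =
            (\<Sum>k = r..<n. if k = j then of_bool (i = j) * (real n - p j) else 0)"
          using ij 3 r by (intro sum.cong) (auto simp: P_def T_def)
        then show ?thesis using ij 3 by simp
      qed
      have "(\<Sum>k = 1..<r. P $$ (i, k) * T $$ (k, j)) =
          (\<Sum>k = 1..<r. of_bool (d i = d k) * (of_bool (d k = d j) - of_bool (d j = d 0)))"
        using ij 3 r by (intro sum.cong) (auto simp: P_def T_def)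
      also have "\<dots> = (if d i = d 0 then 0 else of_bool (d i = d j) - of_bool (d j = d 0))"
        using sum_rep[OF ij(1) k', of "\<lambda>k. of_bool (d k = d j) - of_bool (d j = d 0)"] k' by simp
      finally have 6: "(\<Sum>k = 1..<r. P $$ (i, k) * T $$ (k, j)) = \<dots>" .
      \<comment> \<open>The three ranges correspond to the three kinds of basis vectors.\<close>
      have "{0..<n} = insert 0 ({1..<r} \<union> {r..<n})" using r by auto
      then have "(P * T) $$ (i, j) = P $$ (i, 0) * T $$ (0, j) +
          ((\<Sum>k = 1..<r. P $$ (i, k) * T $$ (k, j)) + (\<Sum>k = r..<n. P $$ (i, k) * T $$ (k, j)))"
        unfolding PT using r by (simp add: sum.union_disjoint)
      also have "\<dots> = of_bool (i = j) * (real n - p i) - 1 + of_bool (d j = d i)"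
        unfolding 5 6 using ij 3 r by (auto simp: P_def T_def)
      also have "\<dots> = (L * P) $$ (i, j)"
      proof -
        have "(\<Sum>k = 0..<n. P $$ (k, j)) = (\<Sum>k = 0..<n. if k = j then 1 else 0)"
          by (intro sum.cong) (auto simp: 4)
        moreover have "(\<Sum>k = 0..<n. of_bool (d k = d i) * P $$ (k, j)) =
            (\<Sum>k = 0..<n. if k = j then of_bool (d j = d i) else 0)"
          by (intro sum.cong) (auto simp: 4)
        ultimately show ?thesis
          unfolding LP using ij by (simp add: 4)
      qed
      finally show ?thesis by simp
    qed
  qed (auto simp: P_def T_def L)
  have "L = L * (P * Q)" using Q carr by simp
  also have "\<dots> = P * T * Q" using Q(1) carr LP by (simp flip: assoc_mult_mat)
  finally have "similar_mat L T"
    using carr Q by (intro similar_matI[of _ _ P Q n]) auto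
  then have "char_poly L = char_poly T" by (rule char_poly_similar)
  also have "\<dots> = (\<Prod>a\<leftarrow>diag_mat T. [:- a, 1:])"
    using r by (intro char_poly_upper_triangular[OF carr(2)] upper_triangularI) (auto simp: T_def)
  also have "diag_mat T =
    map (\<lambda>i. if i = 0 then 0 else if i < r then real n else real n - p i) [0..<n]"
    by (auto simp: diag_mat_def T_def)
  finally show ?thesis by (simp add: comp_def)
qed

lemma proots_prod_list_linear:
  fixes g :: "'a \<Rightarrow> 'b :: idom"
  shows "proots (\<Prod>x\<leftarrow>xs. [:- g x, 1:]) = image_mset g (mset xs)"
proof (induction xs)
  case (Cons x xs)
  have "(\<Prod>x\<leftarrow>xs. [:- g x, 1:]) \<noteq> 0"
    by (auto simp: prod_list_zero_iff)
  then have "proots ([:- g x, 1:] * (\<Prod>x\<leftarrow>xs. [:- g x, 1:])) =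
      proots [:- g x, 1:] + proots (\<Prod>x\<leftarrow>xs. [:- g x, 1:])"
    by (intro proots_mult) auto
  then show ?case using Cons by simp
qed simp

text \<open>Listing the transversal \<open>rs\<close> of the fibres of \<open>c\<close> first gives
  the ordering that \<open>char_poly_complete_multipartite\<close> expects. The head of
  \<open>rs\<close> then yields the eigenvalue 0, the rest of \<open>rs\<close> yields
  \<open>card V\<close>, and each label in \<open>ws\<close> yields \<open>card V\<close> minus the
  size of its part. The map \<open>f\<close> lets the vertices be handled through simpler
  labels.\<close>

lemma laplacian_spectrum_complete_multipartite:
  fixes G :: "'a pair_pre_digraph" and f :: "'v \<Rightarrow> 'a" and c :: "'v \<Rightarrow> 'b" and rs ws :: "'v list"
  defines "V \<equiv> set (rs @ ws)"
  assumes dist: "distinct (rs @ ws)" and f: "inj_on f V"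
    and rs: "rs \<noteq> []" "inj_on c (set rs)" "c ` set ws \<subseteq> c ` set rs"
    and G: "pverts G = f ` V" "parcs G = {(f x, f y) | x y. x \<in> V \<and> y \<in> V \<and> c x \<noteq> c y}"
  shows "laplacian_spectrum G =
    {#0#} + replicate_mset (length rs - 1) (real (card V))
      + {#real (card V) - real (card {v \<in> V. c v = c w}). w \<in># mset ws#}"
proof -
  define us where "us = rs @ ws"
  define n where "n = length us"
  define r where "r = length rs"
  define d where "d = (\<lambda>i. c (us ! i))"
  have V: "V = set us" "card V = n"
    using distinct_card[OF dist] by (simp_all add: V_def us_def n_def)
  have us: "distinct us" using dist by (simp add: us_def)
  have p: "card {v \<in> V. c v = c x} = card {k. k < n \<and> d k = c x}" for x
  proof -
    have "bij_betw ((!) us) {k. k < n \<and> d k = c x} {v \<in> V. c v = c x}"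
      unfolding V by (rule bij_betw_subset[OF bij_betw_nth[OF us refl refl]])
        (auto simp: n_def d_def set_conv_nth)
    then show ?thesis by (simp add: bij_betw_same_card)
  qed
  have deg: "real (out_degree (with_proj G) (f x)) = real n - real (card {v \<in> V. c v = c x})"
    if x: "x \<in> V" for x
  proof -
    have "out_arcs (with_proj G) (f x) = (\<lambda>y. (f x, f y)) ` (V - {v \<in> V. c v = c x})"
      using x by (auto simp: out_arcs_def G inj_on_eq_iff[OF f]) metis
    moreover have "inj_on (\<lambda>y. (f x, f y)) (V - {v \<in> V. c v = c x})"
      using f by (auto simp: inj_on_def)
    ultimately have "out_degree (with_proj G) (f x) = card (V - {v \<in> V. c v = c x})"
      by (simp add: out_degree_def card_image)
    also have "\<dots> = card V - card {v \<in> V. c v = c x}"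
      by (rule card_Diff_subset) (auto simp: V)
    finally have "out_degree (with_proj G) (f x) = card V - card {v \<in> V. c v = c x}" .
    moreover have "card {v \<in> V. c v = c x} \<le> card V"
      by (rule card_mono) (auto simp: V)
    ultimately show ?thesis by (simp add: V(2) of_nat_diff)
  qed
  have arcs: "(f x, f y) \<in> parcs G \<longleftrightarrow> c x \<noteq> c y" if "x \<in> V" "y \<in> V" for x y
    using that by (auto simp: G inj_on_eq_iff[OF f])
  have mem: "us ! i \<in> V" if "i < n" for i
    using that by (simp add: V n_def)
  have L: "laplacian_matrix G (map f us) = mat n n (\<lambda>(i, j).
      (if i = j then real n - real (card {k. k < n \<and> d k = d i}) else 0) - (if d i \<noteq> d j then 1 else 0))"
    by (rule eq_matI)
      (auto simp: laplacian_matrix_def degree_matrix_def adjacency_matrix_def arcs mem deg d_def p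
        simp flip: n_def)
  have nth_rs: "us ! i = rs ! i" if "i < r" for i
    using that by (simp add: us_def r_def nth_append)
  have "inj_on d {..<r}"
  proof (rule inj_onI)
    fix x y assume "x \<in> {..<r}" "y \<in> {..<r}" "d x = d y"
    then have xy: "x < length rs" "y < length rs" "c (rs ! x) = c (rs ! y)"
      by (simp_all add: d_def nth_rs r_def)
    then have "rs ! x = rs ! y" by (intro inj_onD[OF rs(2)]) simp_all
    then show "x = y" using xy dist by (simp add: nth_eq_iff_index_eq)
  qed
  moreover have "d i \<in> d ` {..<r}" if "i < n" for i
  proof -
    have "c (us ! i) \<in> c ` set rs"
      using mem[OF that] rs(3) by (auto simp: V us_def)
    then obtain k where "k < r" "c (us ! i) = c (rs ! k)"
      by (auto simp: in_set_conv_nth r_def)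
    then show ?thesis by (auto simp: d_def nth_rs intro: image_eqI[of _ _ k])
  qed
  moreover have r: "0 < r" "r \<le> n"
    using rs(1) by (simp_all add: r_def n_def us_def)
  ultimately have "char_poly (laplacian_matrix G (map f us)) =
      (\<Prod>i\<leftarrow>[0..<n]. [:- (if i = 0 then 0 else if i < r then real n
        else real n - real (card {k. k < n \<and> d k = d i})), 1:])"
    by (intro char_poly_complete_multipartite[OF _ _ _ _ refl L]) auto
  then have "eigenvalue_mset (laplacian_matrix G (map f us)) =
      mset (map (\<lambda>i. if i = 0 then 0 else if i < r then real n
        else real n - real (card {k. k < n \<and> d k = d i})) [0..<n])" (is "_ = mset (map ?e _)")
    by (simp only: eigenvalue_mset_def proots_prod_list_linear mset_map)
  moreover have "[0..<n] = 0 # [1..<r] @ [r..<n]"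
    using r upt_add_eq_append[of 0 r "n - r"] by (simp add: upt_conv_Cons)
  moreover have "map ?e (0 # [1..<r] @ [r..<n]) = 0 # map (\<lambda>_. real n) [1..<r] @
      map (\<lambda>i. real n - real (card {k. k < n \<and> d k = d i})) [r..<n]"
    using r by auto
  moreover have "map (\<lambda>i. real n - real (card {k. k < n \<and> d k = d i})) [r..<n] =
      map (\<lambda>w. real n - real (card {v \<in> V. c v = c w})) ws"
    by (rule nth_equalityI) (auto simp: n_def us_def r_def d_def p nth_append)
  ultimately have "eigenvalue_mset (laplacian_matrix G (map f us)) =
      mset (0 # map (\<lambda>_. real n) [1..<r] @ map (\<lambda>w. real n - real (card {v \<in> V. c v = c w})) ws)"
    by (simp only:)
  moreover have "laplacian_spectrum G = eigenvalue_mset (laplacian_matrix G (map f us))"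
    using us f by (intro laplacian_spectrum_eq) (auto simp: distinct_map V G)
  ultimately show ?thesis
    by (simp add: V(2) r_def map_replicate_const)
qed

section \<open>Word problem of the dihedral presentation\<close>

text \<open>The pair \<open>(k, s)\<close> encodes the affine map \<open>x \<mapsto> s * x + k\<close> on the integers; \<open>a\<close> acts as the
  translation by 1 and \<open>b\<close> as the negation. With \<open>k\<close> taken modulo \<open>m\<close>, the pair depends only on the
  group element and separates the normal forms of words.\<close>

fun dihedral_eval :: "dihedral_gen word \<Rightarrow> int \<times> int" where
  "dihedral_eval [] = (0, 1)"
| "dihedral_eval ((Gen_a, e) # w) =
     (fst (dihedral_eval w) + (if e then 1 else - 1), snd (dihedral_eval w))"
| "dihedral_eval ((Gen_b, e) # w) = (- fst (dihedral_eval w), - snd (dihedral_eval w))"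

text \<open>Concatenation of words is composition of affine maps, the right word acting
  first.\<close>

lemma dihedral_eval_append:
  "dihedral_eval (u @ v) =
     (fst (dihedral_eval u) + snd (dihedral_eval u) * fst (dihedral_eval v),
      snd (dihedral_eval u) * snd (dihedral_eval v))"
  by (induction u rule: dihedral_eval.induct) (auto simp: algebra_simps)

lemma dihedral_eval_replicate [simp]:
  "dihedral_eval (replicate k (Gen_a, True)) = (int k, 1)"
  by (induction k) auto

text \<open>The signs are compared exactly and not modulo \<open>m\<close>, so reflections stay
  apart from rotations even if \<open>m\<close> is 1 or 2.\<close>

definition dihedral_cong :: "nat \<Rightarrow> dihedral_gen word \<Rightarrow> dihedral_gen word \<Rightarrow> bool" where
  "dihedral_cong m u v \<longleftrightarrow>
     [fst (dihedral_eval u) = fst (dihedral_eval v)] (mod int m) \<and>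
     snd (dihedral_eval u) = snd (dihedral_eval v)"

lemma dihedral_cong_context:
  assumes "dihedral_cong m u v"
  shows "dihedral_cong m (p @ u @ q) (p @ v @ q)"
  using assms unfolding dihedral_cong_def dihedral_eval_append
  by (auto intro!: cong_add cong_mult)

text \<open>Soundness: free cancellation and the relations preserve the affine map modulo
  \<open>m\<close>, in any context. Hence distinct normal forms do not collapse in the presented
  group.\<close>

lemma word_eq_imp_dihedral_cong:
  assumes "word_eq (dihedral_relations m) u v"
  shows "dihedral_cong m u v"
  using assms
proof (induction rule: word_eq.induct)
  case (word_eq_cancel u g s v)
  have "dihedral_cong m [(g, s), (g, \<not> s)] []"
    by (cases g) (auto simp: dihedral_cong_def)
  from dihedral_cong_context[OF this, of u v] show ?case by simp
next
  case (word_eq_rel l r u v)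
  then have "dihedral_cong m l r"
    by (auto simp: dihedral_relations_def dihedral_cong_def numeral_2_eq_2 cong_def)
  then show ?case by (rule dihedral_cong_context)
qed (auto simp: dihedral_cong_def intro: cong_sym cong_trans)

text \<open>These are the normal forms; \<open>s\<close> tells reflections from rotations.\<close>

definition dihedral_word :: "bool \<Rightarrow> nat \<Rightarrow> dihedral_gen word" where
  "dihedral_word s i = replicate i (Gen_a, True) @ (if s then [(Gen_b, True)] else [])"

lemma dihedral_eval_word: "dihedral_eval (dihedral_word s i) = (int i, if s then - 1 else 1)"
  by (simp add: dihedral_word_def dihedral_eval_append)

definition dihedral_reducible :: "nat \<Rightarrow> dihedral_gen word \<Rightarrow> bool" where
  "dihedral_reducible m u \<longleftrightarrow>
     (\<exists>s. \<exists>i<m. word_eq (dihedral_relations m) u (dihedral_word s i))"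

lemma dihedral_reducible_cong:
  assumes "word_eq (dihedral_relations m) u v" "dihedral_reducible m v"
  shows "dihedral_reducible m u"
  using assms unfolding dihedral_reducible_def by (blast intro: word_eq_trans)

lemma dihedral_reducible_word: "i < m \<Longrightarrow> dihedral_reducible m (dihedral_word s i)"
  unfolding dihedral_reducible_def by (blast intro: word_eq_refl)

text \<open>Prefixing \<open>a\<close> or its inverse shifts the exponent of a normal form by one;
  the relation \<open>a^m = 1\<close> brings it back below \<open>m\<close> at both ends of the
  range.\<close>

lemma dihedral_reducible_Cons_a:
  assumes "dihedral_reducible m w"
  shows "dihedral_reducible m ((Gen_a, e) # w)"
proof -
  let ?E = "word_eq (dihedral_relations m)"
  obtain s i where i: "i < m" "?E w (dihedral_word s i)"
    using assms unfolding dihedral_reducible_def by blast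
  then have w: "?E ((Gen_a, e) # w) ((Gen_a, e) # dihedral_word s i)"
    using word_eq_context[of _ w "dihedral_word s i" "[(Gen_a, e)]" "[]"] by simp
  have am: "?E (replicate m (Gen_a, True) @ x) x" for x
    using word_eq_rel[of "replicate m (Gen_a, True)" "[]" _ "[]" x]
    by (simp add: dihedral_relations_def)
  have cancel: "?E ((Gen_a, False) # (Gen_a, True) # x) x" for x
    using word_eq_cancel[of _ "[]" Gen_a False x] by simp
  consider "e" "Suc i = m" | "e" "Suc i < m" | j where "\<not> e" "i = Suc j" | "\<not> e" "i = 0"
    using i(1) by (metis Suc_lessI not0_implies_Suc)
  then have "dihedral_reducible m ((Gen_a, e) # dihedral_word s i)"
  proof cases
    case 1
    then have "(Gen_a, e) # dihedral_word s i = replicate m (Gen_a, True) @ dihedral_word s 0"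
      by (auto simp: dihedral_word_def)
    then show ?thesis
      using am i dihedral_reducible_cong dihedral_reducible_word[of 0 m s] by fastforce
  next
    case 2
    then have "(Gen_a, e) # dihedral_word s i = dihedral_word s (Suc i)"
      by (simp add: dihedral_word_def)
    then show ?thesis using 2 by (simp add: dihedral_reducible_word)
  next
    case 3
    then have "(Gen_a, e) # dihedral_word s i = (Gen_a, False) # (Gen_a, True) # dihedral_word s j"
      by (simp add: dihedral_word_def)
    then show ?thesis
      using 3 i dihedral_reducible_cong[OF cancel dihedral_reducible_word[of j m s]] by simp
  next
    case 4
    obtain k where k: "m = Suc k" using i by (cases m) auto
    \<comment> \<open>At exponent 0 there is no letter to cancel, so \<open>a^m\<close> is inserted
      and \<open>m - 1\<close> letters survive.\<close>
    have "?E ((Gen_a, False) # dihedral_word s 0)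
        ((Gen_a, False) # replicate m (Gen_a, True) @ dihedral_word s 0)"
      using word_eq_context[OF word_eq_sym[OF am[of "dihedral_word s 0"]], of "[(Gen_a, False)]" "[]"]
      by simp
    also have "(Gen_a, False) # replicate m (Gen_a, True) @ dihedral_word s 0 =
        (Gen_a, False) # (Gen_a, True) # dihedral_word s k"
      by (simp add: k dihedral_word_def)
    finally have "?E ((Gen_a, False) # dihedral_word s 0) (dihedral_word s k)"
      using cancel by (blast intro: word_eq_trans)
    then show ?thesis
      using 4 k dihedral_reducible_cong dihedral_reducible_word[of k m s] by auto
  qed
  then show ?thesis using w by (rule dihedral_reducible_cong[rotated])
qed

lemma word_eq_Cons_b_b: "word_eq (dihedral_relations m) ((Gen_b, True) # (Gen_b, True) # x) x"
  using word_eq_rel[of "replicate 2 (Gen_b, True)" "[]" "dihedral_relations m" "[]" x]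
  by (simp add: dihedral_relations_def numeral_2_eq_2)

text \<open>Inserting \<open>b^-1 b\<close> turns the relation \<open>b a b^-1 = a^-1\<close> into a
  rule that moves \<open>b\<close> to the right past \<open>a\<close>.\<close>

lemma word_eq_Cons_b_a:
  "word_eq (dihedral_relations m)
     ((Gen_b, True) # (Gen_a, True) # x) ((Gen_a, False) # (Gen_b, True) # x)"
proof -
  let ?E = "word_eq (dihedral_relations m)"
  have "?E ((Gen_b, True) # (Gen_a, True) # x)
      ((Gen_b, True) # (Gen_a, True) # (Gen_b, False) # (Gen_b, True) # x)"
    using word_eq_cancel[of "dihedral_relations m" "[(Gen_b, True), (Gen_a, True)]" Gen_b False x]
    by (auto intro: word_eq_sym)
  moreover have "?E ((Gen_b, True) # (Gen_a, True) # (Gen_b, False) # (Gen_b, True) # x)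
      ((Gen_a, False) # (Gen_b, True) # x)"
    using word_eq_rel[of "[(Gen_b, True), (Gen_a, True), (Gen_b, False)]" "[(Gen_a, False)]"
        "dihedral_relations m" "[]" "(Gen_b, True) # x"]
    by (simp add: dihedral_relations_def)
  ultimately show ?thesis by (rule word_eq_trans)
qed

text \<open>The letter \<open>b\<close> moves right past the rotation letters one at a time; each
  leaves an inverse of \<open>a\<close> in front, which \<open>dihedral_reducible_Cons_a\<close>
  absorbs. At the end \<open>b\<close> either stays or cancels against a final \<open>b\<close>. A
  letter \<open>b^-1\<close> is replaced by \<open>b\<close>, since \<open>b^2 = 1\<close>.\<close>

lemma dihedral_reducible_Cons_b:
  assumes "dihedral_reducible m w"
  shows "dihedral_reducible m ((Gen_b, e) # w)"
proof -
  let ?E = "word_eq (dihedral_relations m)"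
  obtain s i where i: "i < m" "?E w (dihedral_word s i)"
    using assms unfolding dihedral_reducible_def by blast
  have "dihedral_reducible m ((Gen_b, True) # dihedral_word s i)"
  proof (induction i)
    case 0
    have "?E ((Gen_b, True) # dihedral_word s 0) (dihedral_word (\<not> s) 0)"
      by (cases s) (auto simp: dihedral_word_def word_eq_Cons_b_b word_eq_refl)
    then show ?case
      by (rule dihedral_reducible_cong) (use i(1) in \<open>auto intro: dihedral_reducible_word\<close>)
  next
    case (Suc i)
    have "(Gen_b, True) # dihedral_word s (Suc i) = (Gen_b, True) # (Gen_a, True) # dihedral_word s i"
      by (simp add: dihedral_word_def)
    then show ?case
      using dihedral_reducible_cong[OF word_eq_Cons_b_a dihedral_reducible_Cons_a[OF Suc]] by simp
  qed
  moreover have "?E ((Gen_b, e) # w) ((Gen_b, True) # w)"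
  proof (cases e)
    case False
    have "?E ((Gen_b, False) # w) ((Gen_b, False) # (Gen_b, True) # (Gen_b, True) # w)"
      using word_eq_context[OF word_eq_sym[OF word_eq_Cons_b_b[of m w]], of "[(Gen_b, False)]" "[]"] by simp
    moreover have "?E ((Gen_b, False) # (Gen_b, True) # (Gen_b, True) # w) ((Gen_b, True) # w)"
      using word_eq_cancel[of "dihedral_relations m" "[]" Gen_b False "(Gen_b, True) # w"] by simp
    ultimately show ?thesis using False by (auto intro: word_eq_trans)
  qed (simp add: word_eq_refl)
  moreover have "?E ((Gen_b, True) # w) ((Gen_b, True) # dihedral_word s i)"
    using word_eq_context[OF i(2), of "[(Gen_b, True)]" "[]"] by simp
  ultimately show ?thesis by (blast intro: dihedral_reducible_cong)
qed

lemma dihedral_reducible: "m > 0 \<Longrightarrow> dihedral_reducible m u"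
\<comment> \<open>This rule is list induction split by the generator of the first letter.\<close>
proof (induction u rule: dihedral_eval.induct)
  case 1
  then show ?case using dihedral_reducible_word[of 0 m False] by (simp add: dihedral_word_def)
qed (simp_all add: dihedral_reducible_Cons_a dihedral_reducible_Cons_b)

definition dihedral_elem :: "nat \<Rightarrow> bool \<times> nat \<Rightarrow> dihedral_gen word set" where
  "dihedral_elem m = (\<lambda>(s, i). word_rel (dihedral_relations m) `` {dihedral_word s i})"

lemma carrier_dihedral_group:
  assumes "m > 0"
  shows "carrier (dihedral_group m) = dihedral_elem m ` (UNIV \<times> {..<m})"
proof -
  have "word_rel (dihedral_relations m) `` {u} \<in> dihedral_elem m ` (UNIV \<times> {..<m})" for u
    using dihedral_reducible[OF assms, of u]
    by (force simp: dihedral_reducible_def dihedral_elem_def image_iff simp flip: word_class_eq_iff)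
  moreover have "dihedral_elem m x \<in> carrier (dihedral_group m)" for x
    by (auto simp: dihedral_group_def carrier_presented_group dihedral_elem_def split: prod.split)
  ultimately show ?thesis
    by (auto simp: dihedral_group_def carrier_presented_group)
qed

text \<open>The converse of soundness holds because words with the same affine map modulo
  \<open>m\<close> reduce to normal forms with the same map, and these coincide since their
  exponents are below \<open>m\<close>.\<close>

lemma word_eq_dihedral_iff:
  assumes "m > 0"
  shows "word_eq (dihedral_relations m) u v \<longleftrightarrow> dihedral_cong m u v"
proof
  assume uv: "dihedral_cong m u v"
  obtain s i where i: "i < m" "word_eq (dihedral_relations m) u (dihedral_word s i)"
    using dihedral_reducible[OF assms, of u] unfolding dihedral_reducible_def by blast
  obtain t j where j: "j < m" "word_eq (dihedral_relations m) v (dihedral_word t j)"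
    using dihedral_reducible[OF assms, of v] unfolding dihedral_reducible_def by blast
  have "dihedral_cong m (dihedral_word s i) (dihedral_word t j)"
    using uv word_eq_imp_dihedral_cong[OF i(2)] word_eq_imp_dihedral_cong[OF j(2)]
    unfolding dihedral_cong_def by (metis cong_sym cong_trans)
  then have "s = t" "i = j"
    using i(1) j(1)
    by (auto simp: dihedral_cong_def dihedral_eval_word cong_def split: if_splits simp flip: of_nat_mod)
  then show "word_eq (dihedral_relations m) u v"
    using i(2) j(2) by (blast intro: word_eq_sym word_eq_trans)
qed (rule word_eq_imp_dihedral_cong)

lemma inj_on_dihedral_elem:
  assumes "m > 0"
  shows "inj_on (dihedral_elem m) (UNIV \<times> {..<m})"
  using assms
  by (auto simp: inj_on_def dihedral_elem_def word_class_eq_iff word_eq_dihedral_iff dihedral_cong_def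
      dihedral_eval_word cong_def split: if_splits simp flip: of_nat_mod)

section \<open>Commutation and the spectrum of the dihedral graph\<close>

text \<open>Composing the affine maps in either order gives the same sign. With signs
  \<open>sigma\<close> and \<open>tau\<close> the translations differ by
  \<open>i * (1 - tau) - j * (1 - sigma)\<close>, and one minus the sign is 0 for a rotation and 2
  for a reflection.\<close>

lemma dihedral_elem_commute_iff:
  assumes "m > 0"
  shows "dihedral_elem m (s, i) \<otimes>\<^bsub>dihedral_group m\<^esub> dihedral_elem m (t, j) =
         dihedral_elem m (t, j) \<otimes>\<^bsub>dihedral_group m\<^esub> dihedral_elem m (s, i) \<longleftrightarrow>
     int m dvd 2 * (of_bool t * int i - of_bool s * int j)"
  using assms
  by (auto simp: dihedral_elem_def dihedral_group_def mult_presented_group word_class_eq_iff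
      word_eq_dihedral_iff dihedral_cong_def dihedral_eval_word dihedral_eval_append cong_iff_dvd_diff
      algebra_simps)

text \<open>For \<open>r = 0\<close> this counts the central rotations, and in general the
  reflections in one part.\<close>

lemma card_residue_class:
  fixes h q r :: nat
  assumes "r < h"
  shows "card {i. i < q * h \<and> i mod h = r} = q"
proof -
  have "{i. i < q * h \<and> i mod h = r} = (\<lambda>k. k * h + r) ` {..<q}"
  proof (intro equalityI subsetI)
    fix i assume "i \<in> {i. i < q * h \<and> i mod h = r}"
    then have "i = i div h * h + r" "i div h < q"
      by (auto simp: less_mult_imp_div_less)
    then show "i \<in> (\<lambda>k. k * h + r) ` {..<q}" by blast
  next
    fix i assume "i \<in> (\<lambda>k. k * h + r) ` {..<q}"
    then obtain k where k: "k < q" "i = k * h + r" by auto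
    then have "i < Suc k * h" using assms by simp
    also have "\<dots> \<le> q * h" using k by (intro mult_le_mono) auto
    finally show "i \<in> {i. i < q * h \<and> i mod h = r}" using k assms by simp
  qed
  moreover have "inj_on (\<lambda>k. k * h + r) {..<q}"
    using assms by (auto simp: inj_on_def)
  ultimately show ?thesis by (simp add: card_image)
qed

text \<open>Here \<open>q\<close> is the order of the centre, and \<open>h\<close> is the number of parts that consist of reflections.\<close>

lemma laplacian_spectrum_dihedral:
  fixes m q h :: nat
  assumes m: "m > 2" "m = q * h" and q: "q = 1 \<and> odd m \<or> q = 2"
  shows "laplacian_spectrum (non_commuting_graph (dihedral_group m)) =
    {#0#} + replicate_mset h (2 * real m - real q) + replicate_mset (m - q - 1) (real m)
      + replicate_mset (m - h) (2 * real m - 2 * real q)"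
proof -
  let ?G = "dihedral_group m"
  \<comment> \<open>\<open>c\<close> names the part: 0 for the noncentral rotations, a positive
    number for each class of reflections with exponents congruent modulo \<open>h\<close>.\<close>
  define c where "c = (\<lambda>(s :: bool, i). if s then Suc (i mod h) else 0)"
  \<comment> \<open>These are the exponents of the noncentral rotations; \<open>ks\<close> lists
    those other than 1.\<close>
  define I where "I = {i. i < m \<and> \<not> h dvd i}"
  define ks where "ks = filter (\<lambda>i. i \<in> I) [2..<m]"
  \<comment> \<open>The transversal consists of the rotation \<open>a\<close>, noncentral because
    \<open>1 < h\<close>, and the reflections \<open>a^i b\<close> with
    \<open>i < h\<close>.\<close>
  define rs where "rs = (False, 1) # map (Pair True) [0..<h]"
  define ws where "ws = map (Pair False) ks @ map (Pair True) [h..<m]"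
  define V where "V = {False} \<times> I \<union> {True} \<times> {..<m}"
  have m_pos: "0 < m" using m(1) by simp
  have h: "1 < h" "h \<le> m" using m q by auto
  \<comment> \<open>If \<open>q = 1\<close> then \<open>m = h\<close> is odd and coprime to 2; if
    \<open>q = 2\<close> then \<open>m = 2 * h\<close> and the factor 2 cancels.\<close>
  have dvd_h: "int m dvd 2 * x \<longleftrightarrow> int h dvd x" for x
    using q m by (auto simp: coprime_dvd_mult_right_iff)
  have commute: "dihedral_elem m (s, i) \<otimes>\<^bsub>?G\<^esub> dihedral_elem m (t, j) =
      dihedral_elem m (t, j) \<otimes>\<^bsub>?G\<^esub> dihedral_elem m (s, i) \<longleftrightarrow>
      int h dvd of_bool t * int i - of_bool s * int j" for s t i j
    using dihedral_elem_commute_iff[OF m_pos] unfolding dvd_h .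
  have I: "I = insert 1 (set ks)"
  proof (rule Set.set_eqI)
    fix i :: nat
    consider "i = 0" | "i = 1" | "2 \<le> i" by linarith
    then show "i \<in> I \<longleftrightarrow> i \<in> insert 1 (set ks)"
      using h by cases (auto simp: I_def ks_def)
  qed
  have set_rs_ws: "set (rs @ ws) = V"
  proof -
    have "{..<m} = {0..<h} \<union> {h..<m}" using h by auto
    then show ?thesis using I by (auto simp: rs_def ws_def V_def)
  qed
  have inj: "inj_on (dihedral_elem m) V"
    by (rule inj_on_subset[OF inj_on_dihedral_elem[OF m_pos]]) (auto simp: V_def I_def)
  have carr: "carrier ?G = dihedral_elem m ` (UNIV \<times> {..<m})"
    by (rule carrier_dihedral_group[OF m_pos])
  have center: "dihedral_elem m (s, i) \<in> group_center ?G \<longleftrightarrow> \<not> s \<and> h dvd i" if "i < m" for s i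
  proof
    assume *: "dihedral_elem m (s, i) \<in> group_center ?G"
    have "int h dvd of_bool t * int i - of_bool s * int j" if "j < m" for t j
    proof -
      have "dihedral_elem m (t, j) \<in> carrier ?G"
        unfolding carr using that by blast
      with * show ?thesis
        unfolding group_center_def commute[symmetric] by blast
    qed
    \<comment> \<open>Commuting with \<open>a\<close> forces a rotation, and commuting with
      \<open>b\<close> then forces \<open>h\<close> to divide its exponent.\<close>
    from this[of 1 False] this[of 0 True] show "\<not> s \<and> h dvd i"
      using h m(1) by (cases s) auto
  next
    assume "\<not> s \<and> h dvd i"
    then show "dihedral_elem m (s, i) \<in> group_center ?G"
      using that by (auto simp: group_center_def carr commute)
  qed
  have verts: "carrier ?G - group_center ?G = dihedral_elem m ` V"
  proof -
    have *: "V = {x \<in> UNIV \<times> {..<m}. dihedral_elem m x \<notin> group_center ?G}"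
    proof (rule Set.set_eqI, clarify)
      fix s i
      show "(s, i) \<in> V \<longleftrightarrow> (s, i) \<in> {x \<in> UNIV \<times> {..<m}. dihedral_elem m x \<notin> group_center ?G}"
        by (cases "i < m"; cases s) (simp_all add: V_def I_def center)
    qed
    show ?thesis unfolding carr * by blast
  qed
  have mod_h: "i mod h = j mod h \<longleftrightarrow> int h dvd int i - int j" for i j
    using mod_eq_dvd_iff[of "int i" "int h" "int j"] unfolding of_nat_mod[symmetric] of_nat_eq_iff .
  \<comment> \<open>For a rotation and a reflection, divisibility would make the rotation central,
    which membership in \<open>V\<close> excludes; this matches their different colours.\<close>
  have c: "int h dvd of_bool t * int i - of_bool s * int j \<longleftrightarrow> c (s, i) = c (t, j)"
    if "(s, i) \<in> V" "(t, j) \<in> V" for s t i j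
    using that by (cases s; cases t) (auto simp: V_def I_def c_def mod_h)
  have comm: "dihedral_elem m x \<otimes>\<^bsub>?G\<^esub> dihedral_elem m y =
      dihedral_elem m y \<otimes>\<^bsub>?G\<^esub> dihedral_elem m x \<longleftrightarrow> c x = c y"
    if "x \<in> V" "y \<in> V" for x y
  proof -
    obtain s i t j where "x = (s, i)" "y = (t, j)" by (cases x, cases y)
    then show ?thesis using that c[of s i t j] by (simp only: commute)
  qed
  have "inj_on c (set rs)"
    by (auto simp: rs_def c_def inj_on_def)
  moreover have "c ` set ws \<subseteq> c ` set rs"
    using h by (auto simp: rs_def ws_def c_def image_iff)
  moreover have "distinct (rs @ ws)"
    by (auto simp: rs_def ws_def ks_def distinct_map inj_on_def)
  moreover have "parcs (non_commuting_graph ?G) = {(dihedral_elem m x, dihedral_elem m y) | x y.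
      x \<in> set (rs @ ws) \<and> y \<in> set (rs @ ws) \<and> c x \<noteq> c y}"
  proof -
    have "parcs (non_commuting_graph ?G) =
        {(X, Y). X \<in> dihedral_elem m ` V \<and> Y \<in> dihedral_elem m ` V \<and> X \<otimes>\<^bsub>?G\<^esub> Y \<noteq> Y \<otimes>\<^bsub>?G\<^esub> X}"
      by (simp add: non_commuting_graph_def verts)
    also have "\<dots> = {(dihedral_elem m x, dihedral_elem m y) | x y. x \<in> V \<and> y \<in> V \<and> c x \<noteq> c y}"
    proof (intro equalityI subsetI; clarify)
      fix x y assume "x \<in> V" "y \<in> V" "dihedral_elem m x \<otimes>\<^bsub>?G\<^esub> dihedral_elem m y \<noteq>
        dihedral_elem m y \<otimes>\<^bsub>?G\<^esub> dihedral_elem m x"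
      then show "\<exists>x' y'. (dihedral_elem m x, dihedral_elem m y) =
          (dihedral_elem m x', dihedral_elem m y') \<and> x' \<in> V \<and> y' \<in> V \<and> c x' \<noteq> c y'"
        using comm by (intro exI[of _ x] exI[of _ y]) simp
    qed (simp add: comm)
    finally show ?thesis unfolding set_rs_ws .
  qed
  moreover have "pverts (non_commuting_graph ?G) = dihedral_elem m ` V"
    by (simp add: non_commuting_graph_def verts)
  ultimately have spec: "laplacian_spectrum (non_commuting_graph ?G) =
    {#0#} + replicate_mset (length rs - 1) (real (card V))
      + {#real (card V) - real (card {v \<in> V. c v = c w}). w \<in># mset ws#}"
    using laplacian_spectrum_complete_multipartite[of rs ws "dihedral_elem m" c "non_commuting_graph ?G"]
      inj unfolding set_rs_ws by (simp add: rs_def)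
  have card_I: "card I = m - q"
  proof -
    have *: "I = {..<m} - {i. i < q * h \<and> i mod h = 0}"
      by (auto simp: I_def m(2) dvd_eq_mod_eq_0)
    have "card I = card {..<m} - card {i. i < q * h \<and> i mod h = 0}"
      unfolding * by (rule card_Diff_subset) (auto simp: m(2))
    then show ?thesis using h card_residue_class[of 0 h q] by simp
  qed
  have card_V: "card V = 2 * m - q"
  proof -
    have "finite I" by (simp add: I_def)
    then have "card V = card I + m"
      unfolding V_def by (subst card_Un_disjoint) (auto simp: card_cartesian_product_singleton)
    then show ?thesis using card_I m q by auto
  qed
  have "card (set ks) = length ks"
    by (rule distinct_card) (simp add: ks_def)
  then have "length ks = m - q - 1"
    using card_I by (simp add: I) (simp add: ks_def)
  moreover have "card {v \<in> V. c v = c (False, i)} = m - q" for i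
  proof -
    have "{v \<in> V. c v = c (False, i)} = {False} \<times> I"
      by (auto simp: V_def c_def)
    then show ?thesis by (simp add: card_cartesian_product_singleton card_I)
  qed
  moreover have "card {v \<in> V. c v = c (True, i)} = q" for i
  proof -
    have "{v \<in> V. c v = c (True, i)} = {True} \<times> {j. j < q * h \<and> j mod h = i mod h}"
      by (auto simp: V_def c_def m(2))
    then show ?thesis
      using h by (simp add: card_cartesian_product_singleton card_residue_class)
  qed
  \<comment> \<open>Each remaining rotation lies in a part of size \<open>m - q\<close> and gives
    \<open>(2 * m - q) - (m - q) = m\<close>; each remaining reflection lies in a part of size
    \<open>q\<close> and gives \<open>2 * m - 2 * q\<close>.\<close>
  ultimately have "{#real (card V) - real (card {v \<in> V. c v = c w}). w \<in># mset ws#} =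
      replicate_mset (m - q - 1) (real m) + replicate_mset (m - h) (2 * real m - 2 * real q)"
    using m q by (auto simp: ws_def card_V image_mset.compositionality comp_def image_mset_const_eq of_nat_diff)
  moreover have "real (card V) = 2 * real m - real q"
    using m q by (auto simp: card_V of_nat_diff)
  ultimately show ?thesis
    by (simp add: spec rs_def)
qed

theorem corollary3p6:
  fixes m :: nat
  assumes "m > 2"
  shows "(odd m \<longrightarrow>
            laplacian_spectrum (non_commuting_graph (dihedral_group m)) =
              {#0#} + replicate_mset (m - 2) (real m) + replicate_mset m (2 * real m - 1)) \<and>
         (even m \<longrightarrow>
            laplacian_spectrum (non_commuting_graph (dihedral_group m)) =
              {#0#} + replicate_mset (m - 3) (real m)
                + replicate_mset (m div 2) (2 * real m - 4)
                + replicate_mset (m div 2) (2 * real m - 2))"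
proof (intro conjI impI)
  assume "odd m"
  then show "laplacian_spectrum (non_commuting_graph (dihedral_group m)) =
      {#0#} + replicate_mset (m - 2) (real m) + replicate_mset m (2 * real m - 1)"
    \<comment> \<open>The centre is trivial and every reflection is a part by itself, so the block
      of multiplicity \<open>m - h\<close> is empty.\<close>
    using laplacian_spectrum_dihedral[of m 1 m] assms by (simp add: numeral_2_eq_2)
next
  assume "even m"
  then show "laplacian_spectrum (non_commuting_graph (dihedral_group m)) =
      {#0#} + replicate_mset (m - 3) (real m) + replicate_mset (m div 2) (2 * real m - 4)
        + replicate_mset (m div 2) (2 * real m - 2)"
    \<comment> \<open>The centre has order 2 and the reflections form \<open>m div 2\<close> parts
      of size 2, so \<open>h\<close> and \<open>m - h\<close> agree.\<close>
    using laplacian_spectrum_dihedral[of m 2 "m div 2"] assms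
    by (auto simp: numeral_3_eq_3 elim!: evenE)
qed

end
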